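(* Let $m,n\in\mathbb N_0$, let $q\in\mathbb C$ with $0<|q|<1$, and let $\alpha\in\mathbb C\setminus\{0\}$. Then the continuous $q^{-1}$-Hermite polynomials $\mathsf H_n[z|q]$ satisfy $$\sum_{k=-\infty}^\infty (1+q^{2k}\alpha^2)\,\mathsf H_m[q^k\alpha|q]\,\mathsf H_n[q^k\alpha|q]\,q^{4\binom k2}(q\alpha^4)^k=\Big(q,-\alpha^2,-\frac{q}{\alpha^2};q\Big)_\infty\,\frac{q^{-\binom n2}(q;q)_n}{q^n}\,\delta_{m,n}.$$
   Context: Notation: $\mathbb N_0=\{0,1,2,\dots\}$. For $n\in\mathbb N_0$, $(y;q)_n=\prod_{j=0}^{n-1}(1-yq^j)$, $(y;q)_\infty=\prod_{j\ge0}(1-yq^j)$, and $(y_1,\dots,y_r;q)_\infty=\prod_i(y_i;q)_\infty$. $\binom k2=k(k-1)/2$ for all $k\in\mathbb Z$. $\delta_{m,n}$ is the Kronecker delta. The continuous $q^{-1}$-Hermite polynomials are polynomials of degree $n$ in $x=\frac12(z-z^{-1})$, defined by $\mathsf H_n[z|q]=i^{-n}H_n[iz|q^{-1}]$, where $H_n$ is the continuous $q$-Hermite polynomial in standard normalization, written as a function of $w$ with argument $\frac12(w+w^{-1})$. Explicitly, $$\mathsf H_n[z|q]=z^n\sum_{k=0}^n\frac{(q^{-n};q)_k}{(q;q)_k}(-1)^kq^{\binom k2}\Big(-\frac{q}{z^2}\Big)^k.$$ *)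

theory Defs
  imports "HOL-Analysis.Analysis"
begin

definition qpoch :: "complex \<Rightarrow> complex \<Rightarrow> nat \<Rightarrow> complex" where
  "qpoch y q n = (\<Prod>j<n. 1 - y * q ^ j)"

definition qpoch_inf :: "complex \<Rightarrow> complex \<Rightarrow> complex" where
  "qpoch_inf y q = (\<Prod>j. 1 - y * q ^ j)"

definition qpochs_inf :: "complex list \<Rightarrow> complex \<Rightarrow> complex" where
  "qpochs_inf ys q = (\<Prod>y\<leftarrow>ys. qpoch_inf y q)"

definition int_choose_two :: "int \<Rightarrow> int" where
  "int_choose_two k = k * (k - 1) div 2"

text \<open>
  The continuous \<open>q\<close>-Hermite polynomial \<open>H\<^sub>n(x|q)\<close> in the standard normalization
  (leading coefficient \<open>2\<^sup>n\<close>), as a function of \<open>w\<close> with \<open>x = (w + 1/w)/2\<close>; for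
  \<open>w = exp(\<i>\<theta>)\<close> this is the usual
  \<open>\<Sum>k\<le>n. (q;q)\<^sub>n / ((q;q)\<^sub>k (q;q)\<^sub>n\<^sub>-\<^sub>k) exp(\<i>(n - 2k)\<theta>)\<close>.
  It is used below with base \<open>1/q\<close>, so \<open>|q| < 1\<close> is not built in; the
  formula is meaningful as long as \<open>q\<close> is not a root of unity.
\<close>
definition cont_q_hermite :: "nat \<Rightarrow> complex \<Rightarrow> complex \<Rightarrow> complex" where
  "cont_q_hermite n w q =
     (\<Sum>k\<le>n. qpoch q q n / (qpoch q q k * qpoch q q (n - k)) * w powi (int n - 2 * int k))"

definition cont_qinv_hermite :: "nat \<Rightarrow> complex \<Rightarrow> complex \<Rightarrow> complex" where
  "cont_qinv_hermite n z q = \<i> powi (- int n) * cont_q_hermite n (\<i> * z) (inverse q)"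

lemma qpoch_Suc: "qpoch y q (Suc n) = qpoch y q n * (1 - y * q ^ n)"
  by (simp add: qpoch_def)

lemma qpoch_qq_nonzero:
  assumes "\<And>j. j > 0 \<Longrightarrow> q ^ j \<noteq> 1"
  shows "qpoch q q n \<noteq> 0"
  using assms[of "Suc _"] by (auto simp: qpoch_def)

lemma qpoch_qq_inverse:
  assumes "q \<noteq> 0"
  shows "qpoch (inverse q) (inverse q) n = (- 1) ^ n * inverse q ^ (Suc n choose 2) * qpoch q q n"
proof (induction n)
  case 0
  then show ?case by (simp add: qpoch_def numeral_2_eq_2)
next
  case (Suc n)
  have c: "Suc (Suc n) choose 2 = (Suc n choose 2) + Suc n"
    by (simp add: numeral_2_eq_2)
  have "1 - inverse q * inverse q ^ n = - (inverse q ^ Suc n) * (1 - q * q ^ n)"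
    using assms by (simp add: field_simps)
  then show ?case
    unfolding qpoch_Suc Suc.IH c power_add by simp
qed

lemma qpoch_neg_power:
  assumes "q \<noteq> 0" "k \<le> n"
  shows "qpoch (q powi (- int n)) q k * qpoch q q (n - k) * q ^ (n * k)
       = (- 1) ^ k * q ^ (k choose 2) * qpoch q q n"
  using assms(2)
proof (induction k)
  case 0
  then show ?case by (simp add: qpoch_def numeral_2_eq_2)
next
  case (Suc k)
  then obtain d where d: "n = Suc (k + d)"
    by (metis Suc_le_eq less_iff_Suc_add)
  have c: "Suc k choose 2 = (k choose 2) + k"
    by (simp add: numeral_2_eq_2)
  have nk: "n - k = Suc d" "n - Suc k = d" using d by auto
  have "q ^ n = q * q ^ d * q ^ k"
    using d by (simp add: power_add)
  then have e: "(1 - q powi (- int n) * q ^ k) * q ^ n = - (q ^ k) * (1 - q * q ^ d)"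
    using assms(1) by (simp add: power_int_minus field_simps)
  have IH: "qpoch (q powi (- int n)) q k * (qpoch q q d * (1 - q * q ^ d)) * q ^ (n * k)
       = (- 1) ^ k * q ^ (k choose 2) * qpoch q q n"
    using Suc.IH Suc.prems unfolding nk qpoch_Suc by simp
  have "qpoch (q powi (- int n)) q (Suc k) * qpoch q q (n - Suc k) * q ^ (n * Suc k)
      = qpoch (q powi (- int n)) q k * qpoch q q d * q ^ (n * k)
          * ((1 - q powi (- int n) * q ^ k) * q ^ n)"
    unfolding nk qpoch_Suc by (simp add: power_add mult_ac)
  also have "\<dots> = - (q ^ k) * (qpoch (q powi (- int n)) q k * (qpoch q q d * (1 - q * q ^ d)) * q ^ (n * k))"
    unfolding e by (simp add: mult_ac)
  also have "\<dots> = (- 1) ^ Suc k * q ^ (Suc k choose 2) * qpoch q q n"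
    unfolding IH c power_add by (simp add: mult_ac)
  finally show ?case .
qed

theorem cont_qinv_hermite_explicit:
  assumes "q \<noteq> 0" "z \<noteq> 0" and nr: "\<And>j. j > 0 \<Longrightarrow> q ^ j \<noteq> 1"
  shows "cont_qinv_hermite n z q =
    z ^ n * (\<Sum>k\<le>n. qpoch (q powi (- int n)) q k / qpoch q q k
                     * (- 1) ^ k * q ^ (k choose 2) * (- (q / z\<^sup>2)) ^ k)"
  unfolding cont_qinv_hermite_def cont_q_hermite_def sum_distrib_left
proof (rule sum.cong[OF refl])
  fix k assume "k \<in> {..n}"
  then obtain d where d: "n = k + d" using le_Suc_ex by auto
  define i where "i = inverse q"
  have i: "i * q = 1" "q * i = 1" "i \<noteq> 0" using assms by (auto simp: i_def)
  have ch: "Suc n choose 2 = (Suc k choose 2) + (Suc d choose 2) + k * d" if "n = k + d" for k d n :: nat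
    using that
    by (induction d arbitrary: n) (auto simp: numeral_2_eq_2)
  have nz: "qpoch q q m \<noteq> 0" for m using qpoch_qq_nonzero[OF nr] by blast
  have A: "qpoch i i n / (qpoch i i k * qpoch i i (n - k))
      = i ^ (k * d) * (qpoch q q n / (qpoch q q k * qpoch q q d))"
  proof -
    have nk: "n - k = d" using d by simp
    have s: "(- 1 :: complex) ^ n = (- 1) ^ k * (- 1) ^ d" by (simp add: d power_add)
    show ?thesis
      unfolding i_def qpoch_qq_inverse[OF assms(1)] ch[OF d] power_add nk s
      using assms(1) by (simp add: power_add power_inverse field_simps)
  qed
  have B: "\<i> powi (- int n) * (\<i> * z) powi (int n - 2 * int k) = z ^ n * (- (inverse (z\<^sup>2))) ^ k"
  proof -
    have "\<i> powi (- int n) * (\<i> * z) powi (int n - 2 * int k)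
        = (\<i> powi (- int n) * \<i> powi (int n - 2 * int k)) * z powi (int n - 2 * int k)"
      by (simp add: power_int_mult_distrib mult_ac)
    also have "\<i> powi (- int n) * \<i> powi (int n - 2 * int k) = \<i> powi (- int (2 * k))"
      by (subst power_int_add[symmetric]) auto
    also have "\<dots> = (- 1) ^ k"
      by (simp only: power_int_minus power_int_of_nat power_mult) (simp flip: power_inverse)
    also have "z powi (int n - 2 * int k) = z ^ n * (inverse (z\<^sup>2)) ^ k"
    proof -
      have "z powi (int n - int (2 * k)) = z ^ n / z ^ (2 * k)"
        using assms(2) by (subst power_int_diff) (auto simp del: of_nat_mult)
      then show ?thesis by (simp add: power_mult power_inverse divide_inverse)
    qed
    finally show ?thesis by (simp add: power_minus[of "inverse _"])
  qed
  have kk: "k * k + k = 2 * (k choose 2) + 2 * k"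
    by (induction k) (auto simp: numeral_2_eq_2)
  have C: "qpoch q q n / qpoch q q d * (- 1) ^ k * q ^ (k choose 2)
     = qpoch (q powi (- int n)) q k * q ^ (n * k)"
    using qpoch_neg_power[OF assms(1), of k n] nz[of d] d by (simp add: field_simps)
  have D: "qpoch q q n / qpoch q q d * i ^ (k * d)
     = qpoch (q powi (- int n)) q k * (-1) ^ k * q ^ (k choose 2) * q ^ k"
  proof -
    have "qpoch q q n / qpoch q q d * i ^ (k * d) * ((- 1) ^ k * q ^ (k choose 2))
      = qpoch (q powi (- int n)) q k * (q ^ (n * k) * i ^ (k * d))"
      using arg_cong[OF C, of "\<lambda>t. t * i ^ (k * d)"] by (simp add: mult_ac)
    also have "q ^ (n * k) * i ^ (k * d) = q ^ (k * k) * (q * i) ^ (k * d)"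
      unfolding d by (simp add: power_add power_mult_distrib algebra_simps)
    also have "\<dots> = q ^ (k * k)" using i by simp
    also have "k * k = k + (k choose 2) + (k choose 2)" using kk by simp
    also have "qpoch (q powi (- int n)) q k * q ^ (k + (k choose 2) + (k choose 2))
       = (qpoch (q powi (- int n)) q k * (-1) ^ k * q ^ (k choose 2) * q ^ k) * ((- 1) ^ k * q ^ (k choose 2))"
      by (simp add: power_add mult_ac flip: power_mult_distrib)
    finally have eq: "qpoch q q n / qpoch q q d * i ^ (k * d) * ((- 1) ^ k * q ^ (k choose 2))
       = (qpoch (q powi (- int n)) q k * (-1) ^ k * q ^ (k choose 2) * q ^ k) * ((- 1) ^ k * q ^ (k choose 2))" .
    have "(- 1) ^ k * q ^ (k choose 2) \<noteq> 0" using assms(1) by simp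
    then show ?thesis using eq by (rule mult_right_cancel[THEN iffD1])
  qed
  have "\<i> powi (- int n) * (qpoch i i n / (qpoch i i k * qpoch i i (n - k)) * (\<i> * z) powi (int n - 2 * int k))
      = (qpoch q q n / qpoch q q d * i ^ (k * d)) / qpoch q q k
        * (\<i> powi (- int n) * (\<i> * z) powi (int n - 2 * int k))"
    unfolding A by (simp add: mult_ac)
  also have "\<dots> = z ^ n * (qpoch (q powi (- int n)) q k / qpoch q q k
          * (- 1) ^ k * q ^ (k choose 2) * (q ^ k * (- inverse (z\<^sup>2)) ^ k))"
    unfolding D B by simp
  also have "q ^ k * (- inverse (z\<^sup>2)) ^ k = (- (q / z\<^sup>2)) ^ k"
    by (simp add: divide_inverse flip: power_mult_distrib)
  finally show "\<i> powi (- int n) * (qpoch (inverse q) (inverse q) n /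
        (qpoch (inverse q) (inverse q) k * qpoch (inverse q) (inverse q) (n - k))
         * (\<i> * z) powi (int n - 2 * int k))
      = z ^ n * (qpoch (q powi (- int n)) q k / qpoch q q k
          * (- 1) ^ k * q ^ (k choose 2) * (- (q / z\<^sup>2)) ^ k)"
    unfolding i_def .
qed

end

theory Submission imports Defs begin

text \<open>
  Write \<open>z\<^sub>k = q\<^sup>k \<alpha>\<close> for the nodes, \<open>\<omega>\<^sub>k\<close> for the factor \<open>q powi (4 * int_choose_two k) * (q * \<alpha> ^ 4) powi k\<close>,
  \<open>h\<^sub>n\<close> for the continuous \<open>q\<inverse>\<close>-Hermite polynomials, and
  \<open>L f = (\<Sum>k. \<omega>\<^sub>k (1 + z\<^sub>k\<^sup>2) f(z\<^sub>k))\<close>. The claim is that the \<open>h\<^sub>n\<close> are orthogonal for \<open>L\<close>. By the idea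
  behind Favard's theorem, this follows from three facts.

  The polynomials satisfy \<open>h\<^sub>n\<^sub>+\<^sub>1 = (z - 1/z) h\<^sub>n - (q\<^sup>-\<^sup>n - 1) h\<^sub>n\<^sub>-\<^sub>1\<close>
  (\<open>cont_qinv_hermite_recurrence\<close>). Since multiplication by \<open>z - 1/z\<close> can be moved from one factor
  to the other in \<open>L (h\<^sub>m h\<^sub>n)\<close>, the recurrence determines all these moments from the
  \<open>L h\<^sub>n\<close> (\<open>moment_herm_mult_herm\<close>).

  \<open>L h\<^sub>n = 0\<close> for \<open>n > 0\<close> (\<open>moment_herm_Suc\<close>). The weight satisfies \<open>\<omega>\<^sub>k\<^sub>+\<^sub>1 = q z\<^sub>k\<^sup>4 \<omega>\<^sub>k\<close>, so the series of
  \<open>\<omega>\<^sub>k (g(z\<^sub>k) - q z\<^sub>k\<^sup>4 g(q z\<^sub>k))\<close> telescopes to zero, and with \<open>g(z) = h\<^sub>n\<^sub>+\<^sub>1(z) - z h\<^sub>n(z)\<close> the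
  bracket is exactly \<open>(1 + z\<^sup>2) h\<^sub>n\<^sub>+\<^sub>1(z)\<close>. This is a first-order \<open>q\<close>-difference relation
  (\<open>cont_qinv_hermite_shift\<close>) which comes from comparing the two Pascal rules for
  \<open>q\<close>-binomial coefficients.

  \<open>L 1\<close> is the triple product (\<open>moment_1\<close>): \<open>\<omega>\<^sub>k\<close> and \<open>\<omega>\<^sub>k z\<^sub>k\<^sup>2\<close> are the terms with indices \<open>2k\<close> and
  \<open>2k + 1\<close> of the bilateral series \<open>\<Sum>\<^sub>j q\<^bsup>j(j-1)/2\<^esup> \<alpha>\<^bsup>2j\<^esup>\<close>, which Jacobi's identity evaluates
  (\<open>jacobi_triple_product\<close>). That identity is the limit of a finite one
  (\<open>finite_triple_product\<close>), which is proved by induction with a Pascal rule.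
\<close>

section \<open>Gaussian binomial coefficients\<close>

definition qbin :: "complex \<Rightarrow> nat \<Rightarrow> nat \<Rightarrow> complex" where
  "qbin q n k = (if k \<le> n then qpoch q q n / (qpoch q q k * qpoch q q (n - k)) else 0)"

lemma power_neq_1_of_norm_less_1:
  fixes q :: complex
  assumes "norm q < 1" "j > 0"
  shows "q ^ j \<noteq> 1"
proof
  assume "q ^ j = 1"
  then have "norm q ^ j = 1" by (metis norm_one norm_power)
  moreover have "norm q ^ j < 1" using assms by (simp add: power_less_one_iff)
  ultimately show False by simp
qed

context
  fixes q :: complex
  assumes not_root_of_unity: "\<forall>j>0. q ^ j \<noteq> 1"
begin

lemma qpoch_nz: "qpoch q q n \<noteq> 0"
  using not_root_of_unity by (intro qpoch_qq_nonzero) blast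

lemma one_minus_power_nz: "1 - q * q ^ n \<noteq> 0"
  using not_root_of_unity[rule_format, of "Suc n"] by simp

lemma qbin_0 [simp]: "qbin q n 0 = 1"
  using qpoch_nz by (simp add: qbin_def qpoch_def[of _ _ 0])

lemma qbin_self [simp]: "qbin q n n = 1"
  using qpoch_nz by (simp add: qbin_def qpoch_def[of _ _ 0])

lemma qbin_absorption:
  "(1 - q ^ Suc k) * qbin q (Suc n) (Suc k) = (1 - q ^ Suc n) * qbin q n k"
  using qpoch_nz one_minus_power_nz[of k] by (simp add: qbin_def qpoch_Suc)

lemma qbin_Suc_Suc_left: "qbin q (Suc n) (Suc k) = q ^ Suc k * qbin q n (Suc k) + qbin q n k"
proof (cases "k < n")
  case True
  then obtain d where d: "n = Suc (k + d)" using less_imp_Suc_add by blast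
  have s: "n - k = Suc d" "n - Suc k = d" using d by auto
  have p: "q ^ n = q * (q ^ d * q ^ k)" by (simp add: d power_add)
  show ?thesis
    using True s qpoch_nz one_minus_power_nz[of k] one_minus_power_nz[of d]
    by (simp add: qbin_def qpoch_Suc divide_simps del: power_Suc)
       (simp add: p algebra_simps)
next
  case False
  then show ?thesis by (cases "k = n") (auto simp: qbin_def[of q n "Suc k"], auto simp: qbin_def)
qed

lemma qbin_Suc_Suc_right:
  "qbin q (Suc n) (Suc k) = qbin q n (Suc k) + q ^ (n - k) * qbin q n k"
proof (cases "k < n")
  case True
  then obtain d where d: "n = Suc (k + d)" using less_imp_Suc_add by blast
  have s: "n - k = Suc d" "n - Suc k = d" using d by auto
  have p: "q ^ n = q * (q ^ d * q ^ k)" by (simp add: d power_add)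
  show ?thesis
    using True s qpoch_nz one_minus_power_nz[of k] one_minus_power_nz[of d]
    by (simp add: qbin_def qpoch_Suc divide_simps del: power_Suc)
       (simp add: p algebra_simps)
next
  case False
  then show ?thesis by (cases "k = n") (auto simp: qbin_def[of q n "Suc k"], auto simp: qbin_def)
qed

lemma sum_qbin_extend: "(\<Sum>k\<le>n. qbin q n k * f k) = f 0 + (\<Sum>k\<le>n. qbin q n (Suc k) * f (Suc k))"
proof -
  have "(\<Sum>k\<le>n. qbin q n k * f k) = (\<Sum>k\<le>Suc n. qbin q n k * f k)"
    by (simp add: qbin_def)
  then show ?thesis by (simp only: sum.atMost_Suc_shift) simp
qed

text \<open>
  The two Pascal rules and the absorption rule in summed form. Every identity below between sums
  over a row of Gaussian binomials, whatever the summand, is an instance of one of these.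
\<close>
lemma sum_qbin_Suc_left:
  "(\<Sum>k\<le>Suc n. qbin q (Suc n) k * f k) =
     (\<Sum>k\<le>n. qbin q n k * (q ^ k * f k)) + (\<Sum>k\<le>n. qbin q n k * f (Suc k))"
  unfolding sum.atMost_Suc_shift sum_qbin_extend[of n "\<lambda>k. q ^ k * f k"] qbin_Suc_Suc_left
  by (simp add: sum.distrib algebra_simps)

lemma sum_qbin_Suc_right:
  "(\<Sum>k\<le>Suc n. qbin q (Suc n) k * f k) =
     (\<Sum>k\<le>n. qbin q n k * f k) + (\<Sum>k\<le>n. qbin q n k * (q ^ (n - k) * f (Suc k)))"
  unfolding sum.atMost_Suc_shift sum_qbin_extend[of n f] qbin_Suc_Suc_right
  by (simp add: sum.distrib algebra_simps)

lemma sum_qbin_absorption: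
  "(\<Sum>k\<le>Suc n. qbin q (Suc n) k * ((1 - q ^ k) * f k)) =
     (1 - q ^ Suc n) * (\<Sum>k\<le>n. qbin q n k * f (Suc k))"
proof -
  have absorb: "qbin q (Suc n) (Suc k) * ((1 - q ^ Suc k) * f (Suc k)) =
      (1 - q ^ Suc n) * (qbin q n k * f (Suc k))" for k
    using qbin_absorption[of k n] by (metis mult.assoc mult.commute)
  then show ?thesis
    unfolding sum.atMost_Suc_shift sum_distrib_left absorb by simp
qed

end

section \<open>Jacobi's triple product identity\<close>

definition theta_term :: "complex \<Rightarrow> complex \<Rightarrow> int \<Rightarrow> complex" where
  "theta_term q w j = q powi int_choose_two j * w powi j"

lemma int_choose_two_Suc: "int_choose_two (j + 1) = int_choose_two j + j"
proof -
  have "(j + 1) * (j + 1 - 1) = j * (j - 1) + j * 2" by (simp add: algebra_simps)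
  then show ?thesis unfolding int_choose_two_def by simp
qed

lemma two_int_choose_two: "2 * int_choose_two j = j * (j - 1)"
  unfolding int_choose_two_def by simp

lemma int_choose_two_of_nat: "int_choose_two (int n) = int (n choose 2)"
proof (induction n)
  case (Suc n)
  then show ?case
    using int_choose_two_Suc[of "int n"] by (simp add: numeral_2_eq_2 add.commute)
qed (simp add: int_choose_two_def)

lemma int_choose_two_minus: "int_choose_two (- j) = int_choose_two j + j"
  using two_int_choose_two[of j] two_int_choose_two[of "-j"] by (simp add: algebra_simps)

lemma theta_term_Suc:
  assumes "q \<noteq> 0" "w \<noteq> 0"
  shows "theta_term q w (j + 1) = theta_term q w j * (q powi j * w)"
  using assms by (simp add: theta_term_def int_choose_two_Suc power_int_add)

lemma theta_term_of_nat: "theta_term q w (int n) = q ^ (n choose 2) * w ^ n"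
  by (simp add: theta_term_def int_choose_two_of_nat)

lemma theta_term_minus:
  assumes "q \<noteq> 0" "w \<noteq> 0"
  shows "theta_term q w (- j) = theta_term q (q / w) j"
  using assms
  by (simp add: theta_term_def int_choose_two_minus power_int_add power_int_minus
      power_int_divide_distrib field_simps)

text \<open>
  With separate numbers of factors \<open>m\<close> and \<open>n\<close>, the identity is proved by adding one factor at a time:
  the Pascal rule splits the longer sum into two copies of the shorter one, because a shift of the
  index multiplies the theta term by a power of \<open>q\<close> that cancels the one in the Pascal rule. The case
  \<open>m = 0\<close> is the \<open>q\<close>-binomial theorem; there the induction passes from \<open>w\<close> to \<open>q * w\<close>.
\<close>
lemma finite_triple_product:
  fixes q w :: complex
  assumes nr: "\<forall>j>0. q ^ j \<noteq> 1" and nz: "q \<noteq> 0" "w \<noteq> 0"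
  shows "qpoch (- (q / w)) q m * qpoch (- w) q n =
         (\<Sum>k\<le>m + n. qbin q (m + n) k * theta_term q w (int k - int m))"
proof (induction m)
  case 0
  show ?case
    using nz(2)
  proof (induction n arbitrary: w)
    case 0
    then show ?case using nr by (simp add: qpoch_def theta_term_def int_choose_two_def)
  next
    case (Suc n)
    have shift: "theta_term q w (int (Suc k)) = w * (q ^ k * theta_term q w (int k))" for k
      using theta_term_Suc[OF nz(1) Suc.prems, of "int k"] by (simp add: add.commute mult_ac)
    have scale: "q ^ k * theta_term q w (int k) = theta_term q (q * w) (int k)" for k
      using nz by (simp add: theta_term_def power_mult_distrib)
    have "(\<Sum>k\<le>Suc n. qbin q (Suc n) k * theta_term q w (int k))
        = (1 + w) * (\<Sum>k\<le>n. qbin q n k * theta_term q (q * w) (int k))"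
      unfolding sum_qbin_Suc_left[OF nr] shift scale
      by (simp add: sum_distrib_left sum.distrib algebra_simps)
    also have "\<dots> = (1 + w) * qpoch (- (q * w)) q n"
      using Suc.IH[of "q * w"] nz Suc.prems by (simp add: qpoch_def[of _ _ 0])
    also have "\<dots> = qpoch (- w) q (Suc n)"
      unfolding qpoch_def prod.lessThan_Suc_shift by (simp add: mult_ac)
    finally show ?case by (simp add: qpoch_def[of _ _ 0])
  qed
next
  case (Suc m)
  have low: "q ^ k * theta_term q w (int k - int (Suc m)) = q ^ Suc m / w * theta_term q w (int k - int m)" for k
  proof -
    have "theta_term q w (int k - int m)
        = theta_term q w (int k - int (Suc m)) * (q powi (int k - int (Suc m)) * w)"
      using theta_term_Suc[OF nz, of "int k - int (Suc m)"] by (simp add: algebra_simps)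
    also have "q powi (int k - int (Suc m)) = q ^ k / q ^ Suc m"
      using nz(1) by (subst power_int_diff) (auto simp del: of_nat_Suc power_Suc)
    finally show ?thesis using nz by simp
  qed
  have "(\<Sum>k\<le>Suc (m + n). qbin q (Suc (m + n)) k * theta_term q w (int k - int (Suc m)))
     = (1 + q ^ Suc m / w) * (\<Sum>k\<le>m + n. qbin q (m + n) k * theta_term q w (int k - int m))"
    unfolding sum_qbin_Suc_left[OF nr] low by (simp add: sum_distrib_left sum.distrib algebra_simps)
  then show ?case using Suc.IH by (simp add: qpoch_Suc algebra_simps)
qed

lemma summable_theta_nat:
  fixes q w :: complex
  assumes "norm q < 1"
  shows "summable (\<lambda>n. norm (q ^ (n choose 2) * w ^ n))"
proof -
  have "(\<lambda>n. norm q ^ n * norm w) \<longlonglongrightarrow> 0 * norm w"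
    by (intro tendsto_mult LIMSEQ_power_zero tendsto_const) (use assms in auto)
  then have "\<forall>\<^sub>F n in sequentially. norm q ^ n * norm w < 1 / 2"
    by (rule order_tendstoD) simp
  then obtain N where N: "\<And>n. n \<ge> N \<Longrightarrow> norm q ^ n * norm w < 1 / 2"
    by (auto simp: eventually_sequentially)
  have c: "Suc n choose 2 = (n choose 2) + n" for n by (simp add: numeral_2_eq_2)
  show ?thesis
  proof (rule summable_ratio_test[where c = "1/2" and N = N])
    fix n assume "n \<ge> N"
    have "norm (q ^ (Suc n choose 2) * w ^ Suc n) =
        norm (q ^ (n choose 2) * w ^ n) * (norm q ^ n * norm w)"
      by (simp add: c power_add norm_mult norm_power mult_ac)
    also have "\<dots> \<le> norm (q ^ (n choose 2) * w ^ n) * (1 / 2)"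
      by (intro mult_left_mono) (use N[OF \<open>n \<ge> N\<close>] in auto)
    finally show "norm (norm (q ^ (Suc n choose 2) * w ^ Suc n))
        \<le> 1 / 2 * norm (norm (q ^ (n choose 2) * w ^ n))" by simp
  qed simp
qed

text \<open>
  The reflection \<open>j \<mapsto> -j\<close> replaces \<open>w\<close> by \<open>q / w\<close>, so both halves of the bilateral series are
  covered by the one-sided case.
\<close>
lemma summable_theta:
  fixes q w :: complex
  assumes "norm q < 1" "q \<noteq> 0" "w \<noteq> 0"
  shows "theta_term q w summable_on UNIV"
proof -
  have nat: "(\<lambda>n. theta_term q v (int n)) summable_on UNIV" for v
    unfolding theta_term_of_nat
    by (rule norm_summable_imp_summable_on) (rule summable_theta_nat[OF assms(1)])
  have "theta_term q w summable_on range int"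
    using nat[of w] by (subst summable_on_reindex) (auto simp: o_def)
  moreover have "theta_term q w summable_on range (\<lambda>n. - int n)"
    using nat[of "q / w"] theta_term_minus[OF assms(2,3)]
    by (subst summable_on_reindex) (auto simp: o_def inj_on_def)
  ultimately have "theta_term q w summable_on (range int \<union> (range (\<lambda>n. - int n) - range int))"
    by (intro summable_on_Un_disjoint) (auto intro: summable_on_subset_banach)
  moreover have "range int \<union> (range (\<lambda>n. - int n) - range int) = UNIV"
  proof -
    have "j \<in> range int \<or> j \<in> range (\<lambda>n. - int n)" for j by (cases j rule: int_cases2) auto
    then show ?thesis by blast
  qed
  ultimately show ?thesis by simp
qed

text \<open>
  Dominated convergence for unordered sums, which are integrals over the counting measure. It
  serves to pass to the limit in the finite triple product.
\<close>
lemma infsum_dominated_convergence: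
  fixes s :: "nat \<Rightarrow> 'a \<Rightarrow> complex"
  assumes lim: "\<And>x. (\<lambda>N. s N x) \<longlonglongrightarrow> f x"
    and bound: "\<And>N x. norm (s N x) \<le> w x" and w: "w summable_on UNIV"
  shows "(\<lambda>N. infsum (s N) UNIV) \<longlonglongrightarrow> infsum f UNIV"
proof -
  have w0: "w x \<ge> 0" for x using bound[of 0 x] norm_ge_zero order_trans by blast
  have f_bound: "norm (f x) \<le> w x" for x
    by (rule LIMSEQ_le_const2[OF tendsto_norm[OF lim]]) (use bound in blast)
  have abs: "Infinite_Set_Sum.abs_summable_on g UNIV"
    if "\<And>x. norm (g x) \<le> w x" for g :: "'a \<Rightarrow> complex"
    unfolding abs_summable_equivalent[symmetric]
    using w by (rule summable_on_comparison_test) (use that in auto)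
  have eq: "infsum g UNIV = integral\<^sup>L (count_space UNIV) g"
    if "\<And>x. norm (g x) \<le> w x" for g :: "'a \<Rightarrow> complex"
    using infsetsum_infsum[of g UNIV] abs[OF that] abs_summable_equivalent
    by (metis infsetsum_def)
  have "integrable (count_space UNIV) w"
    using w w0 abs_summable_equivalent[of w UNIV]
    by (simp add: Infinite_Set_Sum.abs_summable_on_def)
  then have "(\<lambda>N. integral\<^sup>L (count_space UNIV) (s N)) \<longlonglongrightarrow> integral\<^sup>L (count_space UNIV) f"
    by (rule integral_dominated_convergence[rotated 2]) (use lim bound in auto)
  then show ?thesis using eq[of f] eq[of "s _"] f_bound bound by simp
qed

lemma convergent_prod_qpoch:
  fixes y q :: complex
  assumes "norm q < 1"
  shows "convergent_prod (\<lambda>j. 1 - y * q ^ j)"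
proof -
  have "summable (\<lambda>j. norm y * norm q ^ j)"
    using assms by (intro summable_mult summable_geometric) simp
  then have "summable (\<lambda>j. norm ((1 - y * q ^ j) - 1))"
    by (simp add: norm_mult norm_power)
  then show ?thesis
    by (intro abs_convergent_prod_imp_convergent_prod summable_imp_abs_convergent_prod)
qed

lemma qpoch_tendsto:
  assumes "norm q < 1"
  shows "(\<lambda>n. qpoch y q n) \<longlonglongrightarrow> qpoch_inf y q"
proof -
  have "(\<lambda>n. qpoch y q (Suc n)) \<longlonglongrightarrow> qpoch_inf y q"
    using convergent_prod_LIMSEQ[OF convergent_prod_qpoch[OF assms, of y]]
    by (simp add: qpoch_def qpoch_inf_def lessThan_Suc_atMost)
  then show ?thesis by (rule LIMSEQ_imp_Suc)
qed

lemma qpoch_inf_qq_nonzero: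
  assumes "norm q < 1"
  shows "qpoch_inf q q \<noteq> 0"
  unfolding qpoch_inf_def
proof (rule prodinf_nonzero[OF convergent_prod_qpoch[OF assms]])
  show "1 - q * q ^ j \<noteq> 0" for j
    using power_neq_1_of_norm_less_1[OF assms, of "Suc j"] by simp
qed

text \<open>
  The finite identity with \<open>m = n = N\<close> has, after the shift of the index, the coefficient
  \<open>qbin q (2 * N) (N + j)\<close> in front of the \<open>j\<close>-th theta term. It tends to \<open>1 / qpoch_inf q q\<close> for each
  fixed \<open>j\<close> and is bounded uniformly in \<open>N\<close> and \<open>j\<close>, since the sequence \<open>qpoch q q n\<close> has no
  zero terms and converges to a nonzero limit.
\<close>
theorem jacobi_triple_product:
  fixes q w :: complex
  assumes q: "norm q < 1" "q \<noteq> 0" and w: "w \<noteq> 0"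
  shows "(theta_term q w has_sum qpochs_inf [q, - w, - (q / w)] q) UNIV"
proof -
  have nr: "\<forall>j>0. q ^ j \<noteq> 1"
    using power_neq_1_of_norm_less_1 q by blast
  define P where "P = qpoch_inf q q"
  have P: "P \<noteq> 0" unfolding P_def using qpoch_inf_qq_nonzero q by blast
  have qlim: "(\<lambda>n. qpoch q q n) \<longlonglongrightarrow> P" unfolding P_def by (rule qpoch_tendsto[OF q(1)])
  obtain B where B: "\<And>n. norm (qpoch q q n) \<le> B"
    using convergent_imp_Bseq[OF convergentI[OF qlim]] unfolding Bseq_def by blast
  obtain B' where B': "\<And>n. norm (inverse (qpoch q q n)) \<le> B'"
    using convergent_imp_Bseq[OF convergentI[OF tendsto_inverse[OF qlim P]]] unfolding Bseq_def by blast
  have B0: "B \<ge> 0" "B' \<ge> 0" using B[of 0] B'[of 0] norm_ge_zero order_trans by blast+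
  have qbin_bound: "norm (qbin q n k) \<le> B * (B' * B')" for n k
  proof (cases "k \<le> n")
    case True
    have "norm (qbin q n k) = norm (qpoch q q n) *
        (norm (inverse (qpoch q q k)) * norm (inverse (qpoch q q (n - k))))"
      using True by (simp add: qbin_def norm_mult norm_divide norm_inverse field_simps)
    also have "\<dots> \<le> B * (B' * B')"
      by (intro mult_mono B B' mult_nonneg_nonneg B0 norm_ge_zero)
    finally show ?thesis .
  qed (use B0 in \<open>simp add: qbin_def\<close>)
  \<comment> \<open>Cutting the coefficients off outside the finite range turns the finite identities into sums over
    all integers, all dominated by a multiple of the theta series.\<close>
  define c where "c N j = (if j \<in> {- int N..int N} then qbin q (N + N) (nat (j + int N)) else 0)"
    for N :: nat and j :: int
  have c_lim: "(\<lambda>N. c N j) \<longlonglongrightarrow> inverse P" for j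
  proof -
    have up: "filterlim (\<lambda>N. nat (int N + i)) at_top sequentially" for i :: int
      unfolding filterlim_at_top eventually_sequentially
    proof
      fix Z :: nat
      show "\<exists>N. \<forall>n\<ge>N. Z \<le> nat (int n + i)"
        by (rule exI[of _ "Z + nat \<bar>i\<bar>"]) auto
    qed
    have dbl: "filterlim (\<lambda>N::nat. N + N) at_top sequentially"
      by (rule filterlim_at_top_mono[OF filterlim_ident]) auto
    have "(\<lambda>N. qpoch q q (N + N) / (qpoch q q (nat (int N + j)) * qpoch q q (nat (int N + - j))))
        \<longlonglongrightarrow> P / (P * P)"
      using P filterlim_compose[OF qlim dbl] filterlim_compose[OF qlim up[of j]]
        filterlim_compose[OF qlim up[of "- j"]]
      by (intro tendsto_divide tendsto_mult) simp_all
    moreover have "\<forall>\<^sub>F N in sequentially. qpoch q q (N + N) /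
        (qpoch q q (nat (int N + j)) * qpoch q q (nat (int N + - j))) = c N j"
      using eventually_ge_at_top[of "nat \<bar>j\<bar>"]
    proof eventually_elim
      case (elim N)
      then have "N + N - nat (j + int N) = nat (int N - j)" "nat (j + int N) \<le> N + N"
        "j \<in> {- int N..int N}" by auto
      then show ?case by (simp add: c_def qbin_def add.commute)
    qed
    ultimately have "(\<lambda>N. c N j) \<longlonglongrightarrow> P / (P * P)"
      by (rule Lim_transform_eventually)
    moreover have "P / (P * P) = inverse P"
      using P by (simp add: field_simps)
    ultimately show ?thesis by simp
  qed
  have c_bound: "norm (c N j) \<le> B * (B' * B')" for N j
    using qbin_bound B0 by (auto simp: c_def)
  have finite: "infsum (\<lambda>j. c N j * theta_term q w j) UNIV = qpoch (- (q / w)) q N * qpoch (- w) q N"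
    for N
  proof -
    have "infsum (\<lambda>j. c N j * theta_term q w j) UNIV =
        infsum (\<lambda>j. c N j * theta_term q w j) {- int N..int N}"
      by (rule infsum_cong_neutral) (auto simp: c_def)
    also have "\<dots> = (\<Sum>j\<in>{- int N..int N}. qbin q (N + N) (nat (j + int N)) * theta_term q w j)"
      by (simp add: c_def)
    also have "\<dots> = (\<Sum>k\<le>N + N. qbin q (N + N) k * theta_term q w (int k - int N))"
      by (rule sum.reindex_bij_witness[of _ "\<lambda>k. int k - int N" "\<lambda>j. nat (j + int N)"]) auto
    finally show ?thesis using finite_triple_product[OF nr q(2) w, of N N] by simp
  qed
  have summ: "theta_term q w summable_on UNIV"
    by (rule summable_theta[OF q w])
  have "(\<lambda>N. infsum (\<lambda>j. c N j * theta_term q w j) UNIV)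
      \<longlonglongrightarrow> infsum (\<lambda>j. inverse P * theta_term q w j) UNIV"
  proof (rule infsum_dominated_convergence)
    show "(\<lambda>N. c N j * theta_term q w j) \<longlonglongrightarrow> inverse P * theta_term q w j" for j
      by (intro tendsto_mult c_lim tendsto_const)
    show "norm (c N j * theta_term q w j) \<le> B * (B' * B') * norm (theta_term q w j)" for N j
      unfolding norm_mult by (intro mult_right_mono c_bound) simp
    show "(\<lambda>j. B * (B' * B') * norm (theta_term q w j)) summable_on UNIV"
      using summ by (intro summable_on_cmult_right)
        (simp add: summable_on_iff_abs_summable_on_complex)
  qed
  moreover have "(\<lambda>N. infsum (\<lambda>j. c N j * theta_term q w j) UNIV)
      \<longlonglongrightarrow> qpoch_inf (- (q / w)) q * qpoch_inf (- w) q"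
    unfolding finite by (intro tendsto_mult qpoch_tendsto q)
  ultimately have limit_eq: "infsum (\<lambda>j. inverse P * theta_term q w j) UNIV
      = qpoch_inf (- (q / w)) q * qpoch_inf (- w) q"
    by (rule LIMSEQ_unique)
  have factor: "infsum (\<lambda>j. inverse P * theta_term q w j) UNIV = inverse P * infsum (theta_term q w) UNIV"
    by (rule infsum_cmult_right')
  have "infsum (theta_term q w) UNIV = qpochs_inf [q, - w, - (q / w)] q"
    using limit_eq P unfolding factor by (simp add: qpochs_inf_def P_def[symmetric] field_simps)
  then show ?thesis using summ by (simp add: has_sum_iff)
qed

section \<open>Recurrence and difference relations\<close>

text \<open>
  Up to the factor \<open>p\<^bsup>n/2\<^esup>\<close> this is the \<open>q\<close>-Hermite polynomial at \<open>p\<^bsup>-1/2\<^esup> w\<close>; the sum avoids the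
  choice of a square root of \<open>p\<close>.
\<close>
definition cont_q_hermite_twist :: "nat \<Rightarrow> complex \<Rightarrow> complex \<Rightarrow> complex" where
  "cont_q_hermite_twist n w p = (\<Sum>k\<le>n. qbin p n k * (p ^ k * w powi (int n - 2 * int k)))"

lemma cont_q_hermite_qbin:
  "cont_q_hermite n w p = (\<Sum>k\<le>n. qbin p n k * w powi (int n - 2 * int k))"
  unfolding cont_q_hermite_def by (rule sum.cong) (auto simp: qbin_def)

context
  fixes p w :: complex
  assumes not_root_of_unity: "\<forall>j>0. p ^ j \<noteq> 1" and w: "w \<noteq> 0"
begin

lemma powi_drop: "w powi (int (Suc n) - 2 * int (Suc k)) = w powi (int n - 2 * int k) / w"
  using power_int_diff[of w "int n - 2 * int k" 1] w by simp

lemma powi_raise: "w powi (int (Suc n) - 2 * int k) = w * w powi (int n - 2 * int k)"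
proof -
  have e: "int (Suc n) - 2 * int k = 1 + (int n - 2 * int k)" by simp
  show ?thesis unfolding e using w by (subst power_int_add) auto
qed

text \<open>
  The two Pascal rules give two expressions for the next polynomial. The twisted sum appears in
  the one at \<open>w\<close> and in the other at \<open>p * w\<close>; comparing them at neighbouring points of the lattice
  therefore eliminates it, which is how the difference relation below arises.
\<close>
lemma cont_q_hermite_Suc_left:
  "cont_q_hermite (Suc n) w p = w * cont_q_hermite_twist n w p + cont_q_hermite n w p / w"
  unfolding cont_q_hermite_qbin cont_q_hermite_twist_def sum_qbin_Suc_left[OF not_root_of_unity] powi_drop
  unfolding powi_raise
  by (simp add: sum_distrib_left sum_divide_distrib mult_ac)

lemma cont_q_hermite_Suc_right:
  assumes "p \<noteq> 0"
  shows "cont_q_hermite (Suc n) w p = w * cont_q_hermite n w p + cont_q_hermite_twist n (p * w) p / w"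
proof -
  have "p ^ (n - k) * w powi (int n - 2 * int k) = p ^ k * (p * w) powi (int n - 2 * int k)" if "k \<le> n" for k
  proof -
    have "p ^ k * p powi (int n - 2 * int k) = p powi (int k + (int n - 2 * int k))"
      using assms by (subst power_int_add) auto
    also have "int k + (int n - 2 * int k) = int (n - k)" using that by simp
    finally show ?thesis by (simp add: power_int_mult_distrib)
  qed
  then have "cont_q_hermite_twist n (p * w) p = (\<Sum>k\<le>n. qbin p n k * (p ^ (n - k) * w powi (int n - 2 * int k)))"
    unfolding cont_q_hermite_twist_def by (intro sum.cong) auto
  then show ?thesis
    unfolding cont_q_hermite_qbin sum_qbin_Suc_right[OF not_root_of_unity] powi_drop
    unfolding powi_raise
    by (simp add: sum_distrib_left sum_divide_distrib mult_ac)
qed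

text \<open>
  The absorption rule expresses the twisted sum by ordinary polynomials at the same point \<open>w\<close>.
  Together with the first expression for the next polynomial this gives the recurrence.
\<close>
lemma cont_q_hermite_twist_Suc:
  "cont_q_hermite_twist (Suc n) w p =
     cont_q_hermite (Suc n) w p - (1 - p ^ Suc n) * cont_q_hermite n w p / w"
proof -
  have "cont_q_hermite (Suc n) w p - cont_q_hermite_twist (Suc n) w p =
      (\<Sum>k\<le>Suc n. qbin p (Suc n) k * ((1 - p ^ k) * w powi (int (Suc n) - 2 * int k)))"
    unfolding cont_q_hermite_qbin cont_q_hermite_twist_def sum_subtractf[symmetric]
    by (simp only: left_diff_distrib right_diff_distrib mult_1_left)
  also have "\<dots> = (1 - p ^ Suc n) * cont_q_hermite n w p / w"
    unfolding sum_qbin_absorption[OF not_root_of_unity] powi_drop cont_q_hermite_qbin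
    by (simp only: times_divide_eq_right sum_divide_distrib[symmetric])
  finally show ?thesis by (simp add: algebra_simps)
qed

lemma cont_q_hermite_0 [simp]: "cont_q_hermite 0 w p = 1"
  by (simp add: cont_q_hermite_def qpoch_def)

lemma cont_q_hermite_recurrence:
  "cont_q_hermite (Suc n) w p =
     (w + 1 / w) * cont_q_hermite n w p - (1 - p ^ n) * cont_q_hermite (n - 1) w p"
proof (cases n)
  case 0
  then show ?thesis
    unfolding cont_q_hermite_Suc_left by (simp add: cont_q_hermite_twist_def qbin_def qpoch_def)
next
  case (Suc m)
  show ?thesis
    unfolding cont_q_hermite_Suc_left[of n] unfolding Suc cont_q_hermite_twist_Suc
    using w by (simp add: field_simps)
qed

end

lemma i_powi_Suc: "\<i> powi (- int (Suc n)) = - \<i> * \<i> powi (- int n)"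
  by (simp only: power_int_minus power_int_of_nat) simp

lemma inverse_not_root_of_unity:
  fixes q :: complex
  assumes "\<forall>j>0. q ^ j \<noteq> 1"
  shows "\<forall>j>0. inverse q ^ j \<noteq> 1"
  using assms by (simp add: power_inverse)

context
  fixes q :: complex
  assumes not_root_of_unity: "\<forall>j>0. q ^ j \<noteq> 1" and q_nz: "q \<noteq> 0"
begin

lemmas inverse_q = inverse_not_root_of_unity[OF not_root_of_unity]

lemma cont_qinv_hermite_0: "z \<noteq> 0 \<Longrightarrow> cont_qinv_hermite 0 z q = 1"
  by (simp add: cont_qinv_hermite_def cont_q_hermite_0[OF inverse_q])

lemma cont_qinv_hermite_recurrence:
  assumes z: "z \<noteq> 0"
  shows "cont_qinv_hermite (Suc n) z q =
     (z - 1 / z) * cont_qinv_hermite n z q - (inverse q ^ n - 1) * cont_qinv_hermite (n - 1) z q"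
proof -
  have w: "\<i> * z \<noteq> 0" using z by simp
  note rec = cont_q_hermite_recurrence[OF inverse_q w, of n]
  have i: "- (\<i> * (\<i> * z + 1 / (\<i> * z))) = z - 1 / z" using z by (simp add: field_simps)
  show ?thesis
  proof (cases "n = 0")
    case True
    then show ?thesis
      unfolding cont_qinv_hermite_def rec i_powi_Suc using i z by (simp add: algebra_simps)
  next
    case False
    then obtain m where m: "n = Suc m" by (cases n) auto
    show ?thesis
      unfolding cont_qinv_hermite_def rec i_powi_Suc i[symmetric]
      unfolding m diff_Suc_1 i_powi_Suc using z by (simp add: field_simps)
  qed
qed

text \<open>
  For \<open>g(z) = h\<^sub>n\<^sub>+\<^sub>1(z) - z h\<^sub>n(z)\<close> this says \<open>q z\<^sup>4 g(q z) = - z\<^sup>2 h\<^sub>n\<^sub>+\<^sub>1(z) - z h\<^sub>n(z)\<close> after multiplication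
  by \<open>z\<^sup>2\<close>, so that \<open>g(z) - q z\<^sup>4 g(q z) = (1 + z\<^sup>2) h\<^sub>n\<^sub>+\<^sub>1(z)\<close>.
\<close>
lemma cont_qinv_hermite_shift:
  assumes z: "z \<noteq> 0"
  shows "q * z\<^sup>2 * (cont_qinv_hermite (Suc n) (q * z) q - q * z * cont_qinv_hermite n (q * z) q)
       = - (cont_qinv_hermite (Suc n) z q + cont_qinv_hermite n z q / z)"
proof -
  have w: "\<i> * z \<noteq> 0" "\<i> * (q * z) \<noteq> 0" using z q_nz by auto
  have inv: "inverse q \<noteq> 0" using q_nz by simp
  have arg: "inverse q * (\<i> * (q * z)) = \<i> * z" using q_nz by simp
  show ?thesis
    unfolding cont_qinv_hermite_def cont_q_hermite_Suc_left[OF inverse_q w(1)]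
      cont_q_hermite_Suc_right[OF inverse_q w(2) inv] arg i_powi_Suc
    using z q_nz by (simp add: field_simps power2_eq_square)
qed

end

section \<open>The moment functional\<close>

context
  fixes q \<alpha> :: complex
  assumes q: "norm q < 1" "q \<noteq> 0" and \<alpha>: "\<alpha> \<noteq> 0"
begin

lemma q_not_root_of_unity: "\<forall>j>0. q ^ j \<noteq> 1"
  using power_neq_1_of_norm_less_1 q by blast

definition node :: "int \<Rightarrow> complex" where "node k = q powi k * \<alpha>"

definition weight :: "int \<Rightarrow> complex" where "weight k = theta_term (q ^ 4) (q * \<alpha> ^ 4) k"

text \<open>
  A class of functions on the lattice which contains the constants, is closed under the operations
  needed to build products of Hermite polynomials, and on which the moment functional is defined
  and linear. Quantifying over all powers of the node makes the class stable under multiplication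
  by \<open>z\<close> and \<open>1 / z\<close>.
\<close>
definition decaying :: "(int \<Rightarrow> complex) \<Rightarrow> bool" where
  "decaying f \<longleftrightarrow> (\<forall>s::int. (\<lambda>k. weight k * node k powi s * f k) summable_on UNIV)"

abbreviation herm :: "nat \<Rightarrow> int \<Rightarrow> complex" where
  "herm n k \<equiv> cont_qinv_hermite n (node k) q"

definition moment :: "(int \<Rightarrow> complex) \<Rightarrow> complex" where
  "moment f = (\<Sum>\<^sub>\<infinity>k. weight k * (1 + (node k)\<^sup>2) * f k)"

lemma node_nz [simp]: "node k \<noteq> 0"
  using q \<alpha> by (simp add: node_def)

lemma node_Suc: "node (k + 1) = q * node k"
  using q by (simp add: node_def power_int_add)

lemma weight_Suc: "weight (k + 1) = weight k * (q * node k ^ 4)"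
proof -
  have "(q ^ 4) powi k = (q powi k) ^ 4"
    by (simp only: power_int_power power_int_power' mult.commute)
  then show ?thesis
    using q \<alpha> by (simp add: weight_def theta_term_Suc node_def power_mult_distrib)
qed

text \<open>
  Each factor \<open>z\<^sub>k\<^sup>s\<close> only changes the argument of the theta series formed by the weights, and
  theta series converge for every nonzero argument.
\<close>
lemma decaying_1: "decaying (\<lambda>_. 1)"
  unfolding decaying_def
proof
  fix s :: int
  have eq: "weight k * node k powi s * 1 = \<alpha> powi s * theta_term (q ^ 4) (q powi (1 + s) * \<alpha> ^ 4) k" for k
  proof -
    have "(q powi k) powi s = (q powi s) powi k"
      by (simp add: mult.commute flip: power_int_mult)
    then show ?thesis
      using q by (simp add: weight_def theta_term_def node_def power_int_mult_distrib power_int_add)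
  qed
  show "(\<lambda>k. weight k * node k powi s * 1) summable_on UNIV"
    unfolding eq using q \<alpha>
    by (intro summable_on_cmult_right summable_theta) (auto simp: norm_power power_less_one_iff)
qed

lemma decaying_add: "decaying f \<Longrightarrow> decaying g \<Longrightarrow> decaying (\<lambda>k. f k + g k)"
  unfolding decaying_def using summable_on_add by (fastforce simp: distrib_left)

lemma decaying_cmult: "decaying f \<Longrightarrow> decaying (\<lambda>k. c * f k)"
  unfolding decaying_def by (simp add: mult.left_commute[of _ c] summable_on_cmult_right)

lemma decaying_powi: "decaying f \<Longrightarrow> decaying (\<lambda>k. node k powi s * f k)"
proof -
  have absorb: "weight k * node k powi t * (node k powi s * f k) = weight k * node k powi (t + s) * f k" for t k
    by (simp add: power_int_add)
  show "decaying f \<Longrightarrow> decaying (\<lambda>k. node k powi s * f k)"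
    unfolding decaying_def absorb by blast
qed

lemma decaying_herm:
  assumes "decaying f"
  shows "decaying (\<lambda>k. herm n k * f k)"
proof (induction n rule: less_induct)
  case (less n)
  show ?case
  proof (cases n)
    case 0
    then show ?thesis using assms cont_qinv_hermite_0[OF q_not_root_of_unity q(2)] by simp
  next
    case (Suc m)
    have "herm n k * f k = node k powi 1 * (herm m k * f k)
        + ((-1) * (node k powi (-1) * (herm m k * f k))
        + (-(inverse q ^ m - 1)) * (herm (m - 1) k * f k))" for k
      unfolding Suc cont_qinv_hermite_recurrence[OF q_not_root_of_unity q(2) node_nz]
      by (simp add: power_int_minus field_simps)
    moreover have "decaying (\<lambda>k. herm m k * f k)" "decaying (\<lambda>k. herm (m - 1) k * f k)"
      using less.IH Suc by simp_all
    ultimately show ?thesis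
      by (simp only:) (intro decaying_add decaying_cmult decaying_powi; assumption)
  qed
qed

lemma decaying_summable:
  assumes "decaying f"
  shows "(\<lambda>k. weight k * f k) summable_on UNIV"
  using assms[unfolded decaying_def, rule_format, of 0] by simp

lemma moment_summable:
  assumes "decaying f"
  shows "(\<lambda>k. weight k * (1 + (node k)\<^sup>2) * f k) summable_on UNIV"
  using decaying_summable[OF decaying_add[OF assms decaying_powi[OF assms, of 2]]]
  by (simp add: algebra_simps)

lemma moment_add: "decaying f \<Longrightarrow> decaying g \<Longrightarrow> moment (\<lambda>k. f k + g k) = moment f + moment g"
  unfolding moment_def distrib_left[of "_ * _"] by (intro infsum_add moment_summable)

lemma moment_cmult: "moment (\<lambda>k. c * f k) = c * moment f"
  unfolding moment_def by (simp add: mult.left_commute flip: infsum_cmult_right')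

text \<open>
  The weights \<open>weight k\<close> and \<open>weight k * (node k)\<^sup>2\<close> interlace to the theta series with base \<open>q\<close>
  and argument \<open>\<alpha>\<^sup>2\<close>.
\<close>
lemma moment_1: "moment (\<lambda>_. 1) = qpochs_inf [q, - \<alpha>\<^sup>2, - (q / \<alpha>\<^sup>2)] q"
proof -
  let ?t = "theta_term q (\<alpha>\<^sup>2)"
  have even: "?t (2 * k) = weight k" for k
  proof -
    have "int_choose_two (2 * k) = 4 * int_choose_two k + k"
      using two_int_choose_two[of "2 * k"] two_int_choose_two[of k] by (simp add: algebra_simps)
    then show ?thesis
      using q by (simp add: theta_term_def weight_def power_int_add power_int_mult_distrib power_int_mult)
  qed
  have odd: "?t (2 * k + 1) = weight k * (node k)\<^sup>2" for k
    using theta_term_Suc[of q "\<alpha>\<^sup>2" "2 * k"] q \<alpha> even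
    by (simp add: node_def power_mult_distrib power_int_power power_int_power' mult.commute)
  have jtp: "(?t has_sum qpochs_inf [q, - \<alpha>\<^sup>2, - (q / \<alpha>\<^sup>2)] q) UNIV"
    using jacobi_triple_product[OF q, of "\<alpha>\<^sup>2"] \<alpha> by simp
  have "(?t has_sum infsum weight UNIV) (range (\<lambda>k. 2 * k))"
    using decaying_summable[OF decaying_1]
    by (subst has_sum_reindex) (auto simp: inj_on_def o_def even intro: has_sum_infsum)
  moreover have "(?t has_sum infsum (\<lambda>k. weight k * (node k)\<^sup>2) UNIV) (range (\<lambda>k. 2 * k + 1))"
    using decaying_summable[OF decaying_powi[OF decaying_1, of 2]]
    by (subst has_sum_reindex) (auto simp: inj_on_def o_def odd intro: has_sum_infsum)
  moreover have "range (\<lambda>k::int. 2 * k) \<inter> range (\<lambda>k. 2 * k + 1) = {}"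
    by (auto, presburger)
  moreover have "range (\<lambda>k::int. 2 * k) \<union> range (\<lambda>k. 2 * k + 1) = UNIV"
    by (auto simp: image_def) presburger
  ultimately have "(?t has_sum infsum weight UNIV + infsum (\<lambda>k. weight k * (node k)\<^sup>2) UNIV) UNIV"
    using has_sum_Un_disjoint by (metis (no_types, lifting))
  then have "infsum weight UNIV + infsum (\<lambda>k. weight k * (node k)\<^sup>2) UNIV = qpochs_inf [q, - \<alpha>\<^sup>2, - (q / \<alpha>\<^sup>2)] q"
    using jtp has_sum_unique by blast
  moreover have "moment (\<lambda>_. 1) = infsum weight UNIV + infsum (\<lambda>k. weight k * (node k)\<^sup>2) UNIV"
    unfolding moment_def mult_1_right distrib_left
    using decaying_summable[OF decaying_1] decaying_summable[OF decaying_powi[OF decaying_1, of 2]]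
    by (intro infsum_add) auto
  ultimately show ?thesis by simp
qed

text \<open>
  The summand is a difference \<open>g k - g (k + 1)\<close> of a summable function on the integers.
\<close>
lemma moment_herm_Suc: "moment (herm (Suc n)) = 0"
proof -
  define g where "g k = weight k * (herm (Suc n) k - node k * herm n k)" for k
  have "decaying (\<lambda>k. herm (Suc n) k * 1 + (-1) * (node k powi 1 * (herm n k * 1)))"
    by (intro decaying_add decaying_cmult decaying_powi decaying_herm decaying_1)
  then have g: "g summable_on UNIV"
    unfolding g_def using decaying_summable by fastforce
  have "weight k * (1 + (node k)\<^sup>2) * herm (Suc n) k = g k - g (k + 1)" for k
  proof -
    have "g (k + 1) = weight k * (node k)\<^sup>2 * (q * (node k)\<^sup>2 *
        (cont_qinv_hermite (Suc n) (q * node k) q - q * node k * cont_qinv_hermite n (q * node k) q))"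
      by (simp add: g_def weight_Suc node_Suc power2_eq_square power4_eq_xxxx mult_ac)
    also have "\<dots> = - weight k * (node k)\<^sup>2 * (herm (Suc n) k + herm n k / node k)"
      unfolding cont_qinv_hermite_shift[OF q_not_root_of_unity q(2) node_nz] by (simp add: algebra_simps)
    also have "\<dots> = - weight k * ((node k)\<^sup>2 * herm (Suc n) k + node k * herm n k)"
      using node_nz[of k] by (simp add: field_simps power2_eq_square)
    finally have step: "g (k + 1) = - weight k * ((node k)\<^sup>2 * herm (Suc n) k + node k * herm n k)" .
    show ?thesis unfolding step g_def[of k] by (simp add: algebra_simps)
  qed
  moreover have "((\<lambda>k. g (k + 1)) has_sum infsum g UNIV) UNIV"
  proof -
    have "bij (\<lambda>k::int. k + 1)"
      by (rule bij_betw_byWitness[of _ "\<lambda>k. k - 1"]) auto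
    then show ?thesis
      using has_sum_infsum[OF g] has_sum_reindex_bij_betw[of _ UNIV UNIV g] by blast
  qed
  ultimately have "((\<lambda>k. weight k * (1 + (node k)\<^sup>2) * herm (Suc n) k) has_sum (infsum g UNIV - infsum g UNIV)) UNIV"
    using has_sum_add[OF has_sum_infsum[OF g], of "\<lambda>k. - g (k + 1)" "- infsum g UNIV"]
    by (simp add: has_sum_uminus)
  then show ?thesis unfolding moment_def by (simp add: infsumI)
qed

text \<open>
  Both sides are the moment of \<open>(z - 1/z) h\<^sub>m h\<^sub>n\<close>, expanded by the recurrence for \<open>h\<^sub>m\<close> and for \<open>h\<^sub>n\<close>.
  For index \<open>0\<close> the coefficient \<open>inverse q ^ 0 - 1\<close> vanishes, so the truncated \<open>0 - 1\<close> is harmless.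
\<close>
lemma moment_herm_exchange:
  "moment (\<lambda>k. herm (Suc m) k * herm n k) + (inverse q ^ m - 1) * moment (\<lambda>k. herm (m - 1) k * herm n k)
   = moment (\<lambda>k. herm m k * herm (Suc n) k) + (inverse q ^ n - 1) * moment (\<lambda>k. herm m k * herm (n - 1) k)"
proof -
  have dec: "decaying (\<lambda>k. herm i k * herm j k)" for i j
    using decaying_herm[OF decaying_herm[OF decaying_1], of i j] by simp
  note rec = cont_qinv_hermite_recurrence[OF q_not_root_of_unity q(2) node_nz]
  have "herm (Suc m) k * herm n k + (inverse q ^ m - 1) * (herm (m - 1) k * herm n k)
     = herm m k * herm (Suc n) k + (inverse q ^ n - 1) * (herm m k * herm (n - 1) k)" for k
    unfolding rec[of m] rec[of n] by (simp add: algebra_simps)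
  then have "moment (\<lambda>k. herm (Suc m) k * herm n k + (inverse q ^ m - 1) * (herm (m - 1) k * herm n k))
     = moment (\<lambda>k. herm m k * herm (Suc n) k + (inverse q ^ n - 1) * (herm m k * herm (n - 1) k))"
    by simp
  then show ?thesis
    by (simp add: moment_add moment_cmult dec decaying_cmult)
qed

text \<open>
  In the exchange relation, all terms other than \<open>L (h\<^sub>l\<^sub>+\<^sub>1 h\<^sub>n)\<close> have first index at most \<open>l\<close>, so they
  are known by induction. Of these, the two that are nonzero for \<open>n = l - 1\<close> cancel each other
  there, and only the one for \<open>n = l + 1\<close> survives, with the new factor \<open>q\<^bsup>-(l+1)\<^esup> - 1\<close>.
\<close>
lemma moment_herm_mult_herm:
  "moment (\<lambda>k. herm m k * herm n k) =
     (if m = n then moment (\<lambda>_. 1) * (\<Prod>i<n. inverse q ^ Suc i - 1) else 0)"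
proof (induction m arbitrary: n rule: less_induct)
  case (less m)
  show ?case
  proof (cases m)
    case 0
    then show ?thesis
      using moment_herm_Suc cont_qinv_hermite_0[OF q_not_root_of_unity q(2)]
      by (cases n) simp_all
  next
    case (Suc l)
    have IH: "moment (\<lambda>k. herm i k * herm j k) =
       (if i = j then moment (\<lambda>_. 1) * (\<Prod>i<j. inverse q ^ Suc i - 1) else 0)" if "i \<le> l" for i j
      using less.IH[of i j] that Suc by simp
    have "moment (\<lambda>k. herm m k * herm n k) =
        moment (\<lambda>k. herm l k * herm (Suc n) k)
        + (inverse q ^ n - 1) * moment (\<lambda>k. herm l k * herm (n - 1) k)
        - (inverse q ^ l - 1) * moment (\<lambda>k. herm (l - 1) k * herm n k)"
      using moment_herm_exchange[of l n] Suc by (simp add: algebra_simps)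
    also have "\<dots> = (if m = n then moment (\<lambda>_. 1) * (\<Prod>i<n. inverse q ^ Suc i - 1) else 0)"
      using Suc by (cases l; cases n) (auto simp: IH)
    finally show ?thesis .
  qed
qed

lemma norm_product:
  "(\<Prod>i<n. inverse q ^ Suc i - 1) = q powi (- int (n choose 2)) * qpoch q q n / q ^ n"
proof (induction n)
  case (Suc n)
  have "Suc n choose 2 = (n choose 2) + n" by (simp add: numeral_2_eq_2)
  moreover have "inverse q ^ Suc n - 1 = (1 - q * q ^ n) / (q * q ^ n)"
    using q by (simp add: field_simps)
  ultimately show ?case
    unfolding prod.lessThan_Suc Suc.IH power_int_minus power_int_of_nat
    using q by (simp add: qpoch_Suc power_add field_simps)
qed (simp add: qpoch_def numeral_2_eq_2)

end

theorem theorem3p6: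
  fixes m n :: nat and q \<alpha> :: complex
  assumes "0 < norm q" and "norm q < 1" and "\<alpha> \<noteq> 0"
  shows "((\<lambda>k::int. (1 + q powi (2 * k) * \<alpha>\<^sup>2)
              * cont_qinv_hermite m (q powi k * \<alpha>) q
              * cont_qinv_hermite n (q powi k * \<alpha>) q
              * q powi (4 * int_choose_two k) * (q * \<alpha> ^ 4) powi k)
          has_sum
          (qpochs_inf [q, - \<alpha>\<^sup>2, - (q / \<alpha>\<^sup>2)] q
              * (q powi (- int (n choose 2)) * qpoch q q n / q ^ n)
              * (if m = n then 1 else 0))) UNIV"
proof -
  have q: "norm q < 1" "q \<noteq> 0" using assms by auto
  note ctx = q assms(3)
  let ?h = "\<lambda>m k. cont_qinv_hermite m (node q \<alpha> k) q"
  have "decaying q \<alpha> (\<lambda>k. ?h m k * ?h n k)"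
    using decaying_herm[OF ctx decaying_herm[OF ctx decaying_1[OF ctx]], of m n] by simp
  then have "((\<lambda>k. weight q \<alpha> k * (1 + (node q \<alpha> k)\<^sup>2) * (?h m k * ?h n k)) has_sum
      moment q \<alpha> (\<lambda>k. ?h m k * ?h n k)) UNIV"
    unfolding moment_def[OF ctx] by (intro has_sum_infsum moment_summable[OF ctx])
  moreover have "weight q \<alpha> k * (1 + (node q \<alpha> k)\<^sup>2) * (?h m k * ?h n k) =
      (1 + q powi (2 * k) * \<alpha>\<^sup>2)
              * cont_qinv_hermite m (q powi k * \<alpha>) q
              * cont_qinv_hermite n (q powi k * \<alpha>) q
              * q powi (4 * int_choose_two k) * (q * \<alpha> ^ 4) powi k" for k
  proof -
    have "q powi (4 * int_choose_two k) = (q ^ 4) powi int_choose_two k"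
      by (simp add: power_int_mult)
    moreover have "q powi (2 * k) * \<alpha>\<^sup>2 = (node q \<alpha> k)\<^sup>2"
      using power_int_mult[of q k 2] by (simp add: node_def[OF ctx] power_mult_distrib mult.commute)
    ultimately show ?thesis
      by (simp add: weight_def[OF ctx] theta_term_def node_def[OF ctx])
  qed
  moreover have "moment q \<alpha> (\<lambda>k. ?h m k * ?h n k) = qpochs_inf [q, - \<alpha>\<^sup>2, - (q / \<alpha>\<^sup>2)] q
      * (q powi (- int (n choose 2)) * qpoch q q n / q ^ n) * (if m = n then 1 else 0)"
    unfolding moment_herm_mult_herm[OF ctx] moment_1[OF ctx] norm_product[OF ctx] by simp
  ultimately show ?thesis
    by simp
qed

end
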